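(* Let $f:\mathbb{R}^d\to\mathbb{R}$ be convex, with non-empty solution set $\mathcal{X}^\star=\{x^\star:f(x^\star)=f^\star\}$, $f^\star=\min_xf(x)$, and $L$-Lipschitz gradient: $\|\nabla f(x)-\nabla f(y)\|_2\le L\|x-y\|_2$ for all $x,y$. Suppose $f$ is coercive (for any sequence $\{x_k\}$, $\lim_k\|x_k-\mathrm{P}_\star(x_k)\|_2=+\infty$ implies $\lim_kf(x_k)=+\infty$) and $\nabla f$ is coercive with respect to $f$ (for any sequence $\{x_k\}$, $\lim_kf(x_k)=+\infty$ implies $\lim_k\|\nabla f(x_k)\|_2=+\infty$). Let $x_{k+1}=x_k-\alpha\hat g_k$ with $\alpha=\frac1L$, where for all $k$ $$\|\nabla f(x_k)-\hat g_k\|_2^2\le\varepsilon_{\mathrm{rel}}\|\nabla f(x_k)\|_2^2+\varepsilon_{\mathrm{abs}},\qquad \varepsilon_{\mathrm{rel}}<1.$$ Let $e_k=f(x_k)-f^\star$. Then, for all $k$, $$e_k\le\max\left\{\frac{4LR^2e_0}{(1-\varepsilon_{\mathrm{rel}})e_0k+4LR^2},\ R\sqrt{\frac{2\varepsilon_{\mathrm{abs}}}{1-\varepsilon_{\mathrm{rel}}}}\right\},$$ where $R$ is a constant, determined by the two coercivity conditions, satisfying $\|x_k-\mathrm{P}_\star(x_k)\|_2\le R$ for all $k$. If instead of the two coercivity conditions $f$ is restricted $\nu$-strongly convex, i.e. $f(x)-\min f\ge\frac\nu2\|x-\mathrm{P}_\star(x)\|_2^2$ for all $x\in\mathbb{R}^d$,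 then this rate improves to $$e_k\le\left(1-\frac{(1-\varepsilon_{\mathrm{rel}})\nu}{4L}\right)^ke_0+\frac{2\varepsilon_{\mathrm{abs}}}{\nu(1-\varepsilon_{\mathrm{rel}})}.$$
   Context: $\mathrm{P}_\star(x)=\mathrm{argmin}_{y\in\mathcal{X}^\star}\|y-x\|_2$ is the projection onto the (closed convex) solution set. $\varepsilon_{\mathrm{rel}},\varepsilon_{\mathrm{abs}}\ge0$ are fixed constants independent of $k$. *)

theory Defs
  imports "HOL-Analysis.Analysis"
begin

text \<open>
  Minimal value and solution set. The minimum is a relation rather than an infimum, since
  \<open>Inf (range f)\<close> is an arbitrary real number when \<open>f\<close> is unbounded below.
\<close>

definition is_minimum_of :: "real \<Rightarrow> ('a \<Rightarrow> real) \<Rightarrow> bool" where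
  "is_minimum_of m f \<longleftrightarrow> m \<in> range f \<and> (\<forall>x. m \<le> f x)"

definition solution_set :: "('a \<Rightarrow> real) \<Rightarrow> real \<Rightarrow> 'a set" where
  "solution_set f fstar = {x. f x = fstar}"

text \<open>
  The library function \<open>closest_point X x\<close> selects a minimiser over \<open>y \<in> X\<close> of the Euclidean
  distance to \<open>x\<close>; for closed convex non-empty \<open>X\<close> it is the projection of \<open>x\<close> onto \<open>X\<close>.
\<close>

definition proj_residual :: "('a::euclidean_space) set \<Rightarrow> 'a \<Rightarrow> real" where
  "proj_residual X x = norm (x - closest_point X x)"

definition coercive :: "('a::euclidean_space \<Rightarrow> real) \<Rightarrow> 'a set \<Rightarrow> bool" where
  "coercive f X \<longleftrightarrow>
     (\<forall>x :: nat \<Rightarrow> 'a.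
        filterlim (\<lambda>k. proj_residual X (x k)) at_top sequentially \<longrightarrow>
        filterlim (\<lambda>k. f (x k)) at_top sequentially)"

definition gradient_coercive ::
    "('a::euclidean_space \<Rightarrow> 'a) \<Rightarrow> ('a \<Rightarrow> real) \<Rightarrow> bool" where
  "gradient_coercive grad f \<longleftrightarrow>
     (\<forall>x :: nat \<Rightarrow> 'a.
        filterlim (\<lambda>k. f (x k)) at_top sequentially \<longrightarrow>
        filterlim (\<lambda>k. norm (grad (x k))) at_top sequentially)"

definition restricted_strongly_convex ::
    "real \<Rightarrow> ('a::euclidean_space \<Rightarrow> real) \<Rightarrow> real \<Rightarrow> bool" where
  "restricted_strongly_convex \<nu> f fstar \<longleftrightarrow>
     (\<forall>x. f x - fstar \<ge> \<nu> / 2 * (proj_residual (solution_set f fstar) x)\<^sup>2)"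

definition inexact_gradient_descent ::
    "('a::euclidean_space \<Rightarrow> 'a) \<Rightarrow> real \<Rightarrow> real \<Rightarrow> real \<Rightarrow> 'a \<Rightarrow> (nat \<Rightarrow> 'a) \<Rightarrow> (nat \<Rightarrow> 'a) \<Rightarrow> bool" where
  "inexact_gradient_descent grad L \<epsilon>rel \<epsilon>abs x0 x g \<longleftrightarrow>
     x 0 = x0 \<and>
     (\<forall>k. x (Suc k) = x k - (1 / L) *\<^sub>R g k) \<and>
     (\<forall>k. (norm (grad (x k) - g k))\<^sup>2 \<le> \<epsilon>rel * (norm (grad (x k)))\<^sup>2 + \<epsilon>abs)"

end

theory Submission
  imports Defs
begin

text \<open>
  Write \<open>e k = f (x k) - f\<^sup>\<star>\<close>, \<open>c = 1 - \<epsilon>\<^sub>r\<^sub>e\<^sub>l\<close>, and \<open>r\<close> for the distance from \<open>x k\<close> to the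
  solution set. The argument rests on three inequalities at \<open>x k\<close>.

  \<^item> Smoothness makes a step of length \<open>1/L\<close> along an approximate gradient \<open>g\<close> decrease \<open>f\<close> by at
    least \<open>(\<parallel>\<nabla>f\<parallel>\<^sup>2 - \<parallel>\<nabla>f - g\<parallel>\<^sup>2) / 2L\<close>: with exactly this step length, the linear and the quadratic
    term of the upper model combine by polarisation. The bound on the gradient error turns this into
    \<open>e (k+1) \<le> e k - (c \<parallel>\<nabla>f\<parallel>\<^sup>2 - \<epsilon>\<^sub>a\<^sub>b\<^sub>s) / 2L\<close> (\<open>inexact_step_decrease\<close>).
  \<^item> Convexity, applied between \<open>x k\<close> and its projection, gives \<open>e k \<le> \<parallel>\<nabla>f\<parallel> r\<close>
    (\<open>gap_le_gradient_times_residual\<close>).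
  \<^item> Smoothness at the projection, where the gradient vanishes, gives \<open>e k \<le> L r\<^sup>2 / 2\<close>
    (\<open>gap_le_residual_squared\<close>).

  If \<open>r \<le> R\<close> throughout, the first two yield the scalar recursion
  \<open>e (k+1) \<le> e k - (c (e k)\<^sup>2 / R\<^sup>2 - \<epsilon>\<^sub>a\<^sub>b\<^sub>s) / 2L\<close>. Above the threshold \<open>E = R \<surd>(2 \<epsilon>\<^sub>a\<^sub>b\<^sub>s / c)\<close> the
  absolute error consumes at most half of the decrease, so \<open>1 / e\<close> grows by \<open>c / 4LR\<^sup>2\<close> per step.
  Once below \<open>E\<close> the gap must stay there, although the recursion alone allows it to increase:
  the third inequality confines all gaps to the range \<open>[0, LR\<^sup>2/2]\<close>, on which the
  right-hand side of the recursion is increasing in \<open>e k\<close>. Either \<open>E\<close> lies above that range, or the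
  right-hand side at \<open>e k \<le> E\<close> is at most its value at \<open>E\<close>, which is at most \<open>E\<close>
  (\<open>sublinear_recursion\<close>).

  A bound \<open>R\<close> exists under coercivity: where \<open>f\<close> is large the gradient beats the absolute
  error and the step does not increase \<open>f\<close>; elsewhere a step increases \<open>f\<close> by at most
  \<open>\<epsilon>\<^sub>a\<^sub>b\<^sub>s / 2L\<close>. So \<open>f\<close> is bounded along all runs from \<open>x0\<close>, and coercivity of \<open>f\<close> bounds the
  residual (\<open>iterates_residual_bounded\<close>).

  Under restricted strong convexity \<open>e k \<le> \<parallel>\<nabla>f\<parallel> r\<close> upgrades to \<open>\<parallel>\<nabla>f\<parallel>\<^sup>2 \<ge> \<nu> e k / 2\<close>, and the recursion
  becomes affine with factor \<open>1 - c \<nu> / 4L\<close> and fixed point \<open>2 \<epsilon>\<^sub>a\<^sub>b\<^sub>s / \<nu> c\<close>. Iterating it needs a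
  nonnegative factor, and comparing the quadratic bounds on the gap gives \<open>\<nu> \<le> L\<close> unless \<open>f\<close> is
  constant (\<open>restricted_strong_convexity_constant_le\<close>).
\<close>

section \<open>Convex functions with Lipschitz gradient\<close>

lemma gderiv_along_line:
  fixes f :: "'a::real_inner \<Rightarrow> real"
  assumes "GDERIV f (x + t *\<^sub>R d) :> g"
  shows "((\<lambda>t. f (x + t *\<^sub>R d)) has_real_derivative g \<bullet> d) (at t within S)"
proof -
  have "((\<lambda>t. x + t *\<^sub>R d) has_derivative (\<lambda>h. h *\<^sub>R d)) (at t within S)"
    by (auto intro!: derivative_eq_intros)
  moreover have "(f has_derivative (\<lambda>h. h \<bullet> g)) (at (x + t *\<^sub>R d))"
    using assms by (simp add: gderiv_def)
  ultimately have "((\<lambda>t. f (x + t *\<^sub>R d)) has_derivative (\<lambda>h. (h *\<^sub>R d) \<bullet> g)) (at t within S)"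
    by (rule has_derivative_compose)
  moreover have "(\<lambda>h. (h *\<^sub>R d) \<bullet> g) = (*) (g \<bullet> d)"
    by (auto simp: inner_commute)
  ultimately show ?thesis
    by (simp add: has_field_derivative_def)
qed

lemma convex_on_above_gradient:
  fixes f :: "'a::real_inner \<Rightarrow> real"
  assumes "convex_on UNIV f" and "GDERIV f x :> g"
  shows "f x + g \<bullet> (y - x) \<le> f y"
proof -
  define h where "h = (\<lambda>t::real. f (x + t *\<^sub>R (y - x)))"
  have "convex_on UNIV h"
  proof (rule convex_onI)
    fix t a b :: real
    assume t: "0 < t" "t < 1"
    have "x + ((1 - t) *\<^sub>R a + t *\<^sub>R b) *\<^sub>R (y - x)
        = (1 - t) *\<^sub>R (x + a *\<^sub>R (y - x)) + t *\<^sub>R (x + b *\<^sub>R (y - x))"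
      by (simp add: algebra_simps)
    then show "h ((1 - t) *\<^sub>R a + t *\<^sub>R b) \<le> (1 - t) * h a + t * h b"
      using convex_onD[OF assms(1), of t "x + a *\<^sub>R (y - x)" "x + b *\<^sub>R (y - x)"] t
      by (simp add: h_def)
  qed simp
  moreover have "(h has_real_derivative g \<bullet> (y - x)) (at 0 within UNIV)"
    unfolding h_def by (rule gderiv_along_line) (simp add: assms(2))
  ultimately have "h 1 - h 0 \<ge> g \<bullet> (y - x) * (1 - 0)"
    by (intro convex_on_imp_above_tangent[where A = UNIV]) auto
  then show ?thesis by (simp add: h_def)
qed

text \<open>
  Along the segment from \<open>x\<close> to \<open>y\<close>, the Lipschitz condition keeps the derivative of \<open>f\<close> below that
  of the quadratic model, so the difference of the two is nonincreasing.
\<close>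

lemma lipschitz_gradient_quadratic_upper_bound:
  fixes f :: "'a::real_inner \<Rightarrow> real"
  assumes grad: "\<And>x. GDERIV f x :> grad x"
    and lip: "\<And>x y. norm (grad x - grad y) \<le> L * norm (x - y)"
  shows "f y \<le> f x + grad x \<bullet> (y - x) + L / 2 * (norm (y - x))\<^sup>2"
proof -
  define d where "d = y - x"
  define h where "h = (\<lambda>t::real. f (x + t *\<^sub>R d) - t * (grad x \<bullet> d) - L / 2 * t\<^sup>2 * (norm d)\<^sup>2)"
  have "h 1 \<le> h 0"
  proof (rule DERIV_nonpos_imp_nonincreasing[of 0 1 h])
    fix t :: real
    assume t: "0 \<le> t" "t \<le> 1"
    have "(h has_real_derivative
        grad (x + t *\<^sub>R d) \<bullet> d - grad x \<bullet> d - L * t * (norm d)\<^sup>2) (at t)"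
      unfolding h_def by (auto intro!: derivative_eq_intros gderiv_along_line grad)
    moreover have "grad (x + t *\<^sub>R d) \<bullet> d - grad x \<bullet> d \<le> L * t * (norm d)\<^sup>2"
    proof -
      have "grad (x + t *\<^sub>R d) \<bullet> d - grad x \<bullet> d \<le> norm (grad (x + t *\<^sub>R d) - grad x) * norm d"
        using norm_cauchy_schwarz[of "grad (x + t *\<^sub>R d) - grad x" d]
        by (simp add: inner_diff_left)
      also have "\<dots> \<le> (L * norm (t *\<^sub>R d)) * norm d"
        using lip[of "x + t *\<^sub>R d" x] by (intro mult_right_mono) auto
      also have "\<dots> = L * t * (norm d)\<^sup>2"
        using t by (simp add: power2_eq_square)
      finally show ?thesis .
    qed
    ultimately show "\<exists>z. (h has_real_derivative z) (at t) \<and> z \<le> 0"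
      by (intro exI[of _ "grad (x + t *\<^sub>R d) \<bullet> d - grad x \<bullet> d - L * t * (norm d)\<^sup>2"]) auto
  qed simp
  then show ?thesis by (simp add: h_def d_def)
qed

section \<open>Optimality gap, gradient and distance to the solution set\<close>

locale smooth_convex_minimisation =
  fixes f :: "'a::euclidean_space \<Rightarrow> real" and grad :: "'a \<Rightarrow> 'a" and L fstar :: real
  assumes convex: "convex_on UNIV f"
    and minimum: "is_minimum_of fstar f"
    and grad: "\<And>x. GDERIV f x :> grad x"
    and L_pos: "L > 0"
    and lipschitz: "\<And>x y. norm (grad x - grad y) \<le> L * norm (x - y)"
begin

abbreviation residual :: "'a \<Rightarrow> real" where
  "residual \<equiv> proj_residual (solution_set f fstar)"

lemma gap_nonneg: "0 \<le> f x - fstar"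
  using minimum by (simp add: is_minimum_of_def)

lemma residual_nonneg: "0 \<le> residual x"
  by (simp add: proj_residual_def)

lemma f_closest_point: "f (closest_point (solution_set f fstar) x) = fstar"
proof -
  have "continuous_on UNIV f"
    using grad by (auto simp: gderiv_def continuous_on_eq_continuous_at intro: has_derivative_continuous)
  then have "closed (solution_set f fstar)"
    unfolding solution_set_def by (intro closed_Collect_eq) auto
  moreover have "solution_set f fstar \<noteq> {}"
    using minimum by (auto simp: is_minimum_of_def solution_set_def)
  ultimately have "closest_point (solution_set f fstar) x \<in> solution_set f fstar"
    by (rule closest_point_in_set)
  then show ?thesis by (simp add: solution_set_def)
qed

lemma gap_le_gradient_times_residual: "f x - fstar \<le> norm (grad x) * residual x"
proof -
  define p where "p = closest_point (solution_set f fstar) x"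
  have "f x - fstar \<le> grad x \<bullet> (x - p)"
    using convex_on_above_gradient[OF convex grad, of x p] f_closest_point[of x]
    by (simp add: p_def inner_diff_right)
  also have "\<dots> \<le> norm (grad x) * norm (x - p)"
    by (rule norm_cauchy_schwarz)
  finally show ?thesis by (simp add: p_def proj_residual_def)
qed

text \<open>
  A minimiser has zero gradient, since otherwise the exact step of length \<open>1/L\<close> would
  go below \<open>fstar\<close>.
\<close>

lemma grad_minimiser:
  assumes "f p = fstar"
  shows "grad p = 0"
proof -
  have "fstar \<le> f (p - (1 / L) *\<^sub>R grad p)"
    using minimum by (simp add: is_minimum_of_def)
  also have "\<dots> \<le> fstar - (norm (grad p))\<^sup>2 / L + L / 2 * (norm (grad p) / L)\<^sup>2"
    using lipschitz_gradient_quadratic_upper_bound[OF grad lipschitz, of "p - (1 / L) *\<^sub>R grad p" p]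
      assms L_pos
    by (simp add: power2_norm_eq_inner)
  also have "\<dots> = fstar - (norm (grad p))\<^sup>2 / (2 * L)"
    using L_pos by (simp add: field_simps power2_eq_square)
  finally show ?thesis using L_pos by (simp add: divide_le_0_iff)
qed

lemma gap_le_residual_squared: "f x - fstar \<le> L / 2 * (residual x)\<^sup>2"
  using lipschitz_gradient_quadratic_upper_bound[OF grad lipschitz, of x "closest_point (solution_set f fstar) x"]
    grad_minimiser[OF f_closest_point] f_closest_point[of x]
  by (simp add: proj_residual_def)

text \<open>
  At a point off the solution set the gap lies between \<open>\<nu> r\<^sup>2 / 2\<close> and \<open>L r\<^sup>2 / 2\<close> with \<open>r > 0\<close>. This
  keeps the contraction factor of the linear rate nonnegative.
\<close>

lemma restricted_strong_convexity_constant_le: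
  assumes "restricted_strongly_convex \<nu> f fstar" and "f x \<noteq> fstar"
  shows "\<nu> \<le> L"
proof -
  have "f x - fstar > 0"
    using gap_nonneg[of x] assms(2) by simp
  with gap_le_residual_squared[of x] have pos: "(residual x)\<^sup>2 > 0"
    using L_pos by (metis less_le_trans mult_zero_right zero_less_power2 not_less_iff_gr_or_eq zero_power2)
  have "\<nu> / 2 * (residual x)\<^sup>2 \<le> L / 2 * (residual x)\<^sup>2"
    using assms(1) gap_le_residual_squared[of x]
    by (auto simp: restricted_strongly_convex_def intro: order_trans)
  with pos show ?thesis by simp
qed

text \<open>
  Squaring \<open>gap \<le> \<parallel>\<nabla>f\<parallel> r\<close> and replacing \<open>r\<^sup>2\<close> by its bound \<open>2 gap / \<nu>\<close> leaves one factor \<open>gap\<close> to cancel.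
\<close>

lemma restricted_strong_convexity_gradient_lower_bound:
  assumes rsc: "restricted_strongly_convex \<nu> f fstar" and "\<nu> > 0"
  shows "\<nu> / 2 * (f x - fstar) \<le> (norm (grad x))\<^sup>2"
proof (cases "f x = fstar")
  case False
  define e where "e = f x - fstar"
  have e: "e > 0"
    using False gap_nonneg[of x] by (simp add: e_def)
  have lower: "\<nu> / 2 * (residual x)\<^sup>2 \<le> e"
    using rsc by (simp add: restricted_strongly_convex_def e_def)
  have "\<nu> / 2 * e\<^sup>2 \<le> \<nu> / 2 * (norm (grad x) * residual x)\<^sup>2"
    using gap_le_gradient_times_residual[of x] e \<open>\<nu> > 0\<close>
    by (intro mult_left_mono power_mono) (auto simp: e_def)
  also have "\<dots> = (norm (grad x))\<^sup>2 * (\<nu> / 2 * (residual x)\<^sup>2)"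
    by (simp add: power_mult_distrib)
  also have "\<dots> \<le> (norm (grad x))\<^sup>2 * e"
    using lower by (rule mult_left_mono) simp
  finally have "\<nu> / 2 * e\<^sup>2 \<le> (norm (grad x))\<^sup>2 * e" .
  then have "(\<nu> / 2 * e) * e \<le> (norm (grad x))\<^sup>2 * e"
    by (simp add: power2_eq_square mult.assoc)
  with e show ?thesis
    unfolding e_def[symmetric] by (rule mult_right_le_imp_le[rotated])
qed simp

section \<open>One inexact gradient step\<close>

lemma inexact_step_decrease:
  assumes run: "inexact_gradient_descent grad L \<epsilon>rel \<epsilon>abs x0 x g"
  shows "f (x (Suc k)) \<le> f (x k) - ((1 - \<epsilon>rel) * (norm (grad (x k)))\<^sup>2 - \<epsilon>abs) / (2 * L)"
proof -
  let ?G = "grad (x k)"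
  have step: "x (Suc k) = x k - (1 / L) *\<^sub>R g k"
    and error: "(norm (?G - g k))\<^sup>2 \<le> \<epsilon>rel * (norm ?G)\<^sup>2 + \<epsilon>abs"
    using run by (auto simp: inexact_gradient_descent_def)
  have polar: "(norm ?G)\<^sup>2 - (norm (?G - g k))\<^sup>2 = 2 * (?G \<bullet> g k) - (norm (g k))\<^sup>2"
    by (simp add: power2_norm_eq_inner inner_diff inner_commute algebra_simps)
  have "f (x (Suc k)) \<le> f (x k) - (?G \<bullet> g k) / L + L / 2 * (norm (g k) / L)\<^sup>2"
    using lipschitz_gradient_quadratic_upper_bound[OF grad lipschitz, of "x (Suc k)" "x k"] L_pos
    by (simp add: step)
  also have "\<dots> = f (x k) - ((norm ?G)\<^sup>2 - (norm (?G - g k))\<^sup>2) / (2 * L)"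
    unfolding polar using L_pos by (simp add: field_simps power2_eq_square)
  also have "\<dots> \<le> f (x k) - ((1 - \<epsilon>rel) * (norm ?G)\<^sup>2 - \<epsilon>abs) / (2 * L)"
    using error L_pos by (intro diff_left_mono divide_right_mono) (auto simp: algebra_simps)
  finally show ?thesis .
qed

section \<open>Coercivity bounds the iterates\<close>

lemma coercive_sublevel_residual_bounded:
  assumes "coercive f (solution_set f fstar)"
  shows "\<exists>R. \<forall>y. f y \<le> B \<longrightarrow> residual y \<le> R"
proof (rule ccontr)
  assume "\<not> ?thesis"
  then have "\<forall>n. \<exists>y. f y \<le> B \<and> residual y > real n"
    by (meson not_le)
  then obtain y where y: "\<And>n. f (y n) \<le> B" "\<And>n. residual (y n) > real n"
    by metis
  have "filterlim (\<lambda>n. residual (y n)) at_top sequentially"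
    by (rule filterlim_at_top_mono[OF filterlim_real_sequentially])
      (auto intro: less_imp_le always_eventually y(2))
  with assms have "filterlim (\<lambda>n. f (y n)) at_top sequentially"
    by (simp add: coercive_def)
  then have "\<forall>\<^sub>F n in sequentially. f (y n) > B"
    by (auto simp: filterlim_at_top_dense)
  then show False
    using y(1) by (auto simp: eventually_sequentially not_less[symmetric])
qed

lemma gradient_coercive_superlevel_gradient_large:
  assumes "gradient_coercive grad f"
  shows "\<exists>M. \<forall>y. M \<le> f y \<longrightarrow> B \<le> norm (grad y)"
proof (rule ccontr)
  assume "\<not> ?thesis"
  then have "\<forall>n. \<exists>y. real n \<le> f y \<and> norm (grad y) < B"
    by (meson not_le)
  then obtain y where y: "\<And>n. real n \<le> f (y n)" "\<And>n. norm (grad (y n)) < B"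
    by metis
  have "filterlim (\<lambda>n. f (y n)) at_top sequentially"
    by (rule filterlim_at_top_mono[OF filterlim_real_sequentially])
      (auto intro: always_eventually y(1))
  with assms have "filterlim (\<lambda>n. norm (grad (y n))) at_top sequentially"
    by (simp add: gradient_coercive_def)
  then have "\<forall>\<^sub>F n in sequentially. norm (grad (y n)) > B"
    by (auto simp: filterlim_at_top_dense)
  then show False
    using y(2) by (auto simp: eventually_sequentially) (meson less_asym order_refl)
qed

lemma iterates_residual_bounded:
  assumes eps: "\<epsilon>rel < 1" "0 \<le> \<epsilon>abs"
    and coercive: "coercive f (solution_set f fstar)" "gradient_coercive grad f"
  shows "\<exists>R. \<forall>x g. inexact_gradient_descent grad L \<epsilon>rel \<epsilon>abs x0 x g \<longrightarrow> (\<forall>k. residual (x k) \<le> R)"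
proof -
  \<comment> \<open>This is the gradient norm from which on the guaranteed decrease is nonnegative.\<close>
  obtain M where M: "\<And>y. M \<le> f y \<Longrightarrow> sqrt (\<epsilon>abs / (1 - \<epsilon>rel)) \<le> norm (grad y)"
    using gradient_coercive_superlevel_gradient_large[OF coercive(2)] by meson
  define B where "B = max (f x0) (M + \<epsilon>abs / (2 * L))"
  obtain R where R: "\<And>y. f y \<le> B \<Longrightarrow> residual y \<le> R"
    using coercive_sublevel_residual_bounded[OF coercive(1)] by meson
  have "f (x k) \<le> B" if run: "inexact_gradient_descent grad L \<epsilon>rel \<epsilon>abs x0 x g" for x g k
  proof (induction k)
    case 0
    show ?case using run by (simp add: inexact_gradient_descent_def B_def)
  next
    case (Suc k)
    note dec = inexact_step_decrease[OF run, of k]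
    show ?case
    proof (cases "M \<le> f (x k)")
      case True
      have "\<epsilon>abs / (1 - \<epsilon>rel) \<le> (norm (grad (x k)))\<^sup>2"
        using power_mono[OF M[OF True], of 2] eps by simp
      then have "\<epsilon>abs \<le> (1 - \<epsilon>rel) * (norm (grad (x k)))\<^sup>2"
        using eps by (simp add: field_simps)
      then have "0 \<le> ((1 - \<epsilon>rel) * (norm (grad (x k)))\<^sup>2 - \<epsilon>abs) / (2 * L)"
        using L_pos by simp
      then show ?thesis using dec Suc by linarith
    next
      case False
      have "0 \<le> (1 - \<epsilon>rel) * (norm (grad (x k)))\<^sup>2 / (2 * L)"
        using eps L_pos by simp
      then show ?thesis using dec False by (simp add: B_def diff_divide_distrib)
    qed
  qed
  with R show ?thesis by blast
qed

end

section \<open>Scalar recursions\<close>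

text \<open>
  A difference \<open>a - q a\<^sup>2\<close> is at most \<open>a / (q a + 1)\<close>, because \<open>(1 - t) (1 + t) \<le> 1\<close>; the latter
  expression is increasing in \<open>a\<close> and maps \<open>a0 / (n q a0 + 1)\<close> to the next value of this sequence.
\<close>

lemma quadratic_decrease_step:
  fixes a b q a0 n :: real
  assumes "b \<le> a - q * a\<^sup>2" "a \<le> a0 / (n * q * a0 + 1)" "0 < a" "0 \<le> a0" "0 \<le> q" "0 \<le> n"
  shows "b \<le> a0 / ((n + 1) * q * a0 + 1)"
proof -
  have pos: "0 < n * q * a0 + 1" "0 < (n + 1) * q * a0 + 1" "0 < q * a + 1"
    using assms by (auto intro!: add_nonneg_pos mult_nonneg_nonneg)
  have "b \<le> a / (q * a + 1)"
  proof -
    have "(a - q * a\<^sup>2) * (q * a + 1) = a - q\<^sup>2 * a ^ 3"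
      by (simp add: algebra_simps power2_eq_square power3_eq_cube)
    also have "\<dots> \<le> a" using assms by simp
    finally have "a - q * a\<^sup>2 \<le> a / (q * a + 1)"
      using pos by (simp add: pos_le_divide_eq)
    with assms(1) show ?thesis by linarith
  qed
  also have "\<dots> \<le> a0 / ((n + 1) * q * a0 + 1)"
  proof -
    have "a * (n * q * a0 + 1) \<le> a0"
      using assms(2) pos by (simp add: pos_le_divide_eq)
    then have "a * ((n + 1) * q * a0 + 1) \<le> a0 * (q * a + 1)"
      by (simp add: algebra_simps)
    then show ?thesis using pos by (simp add: frac_le_eq divide_le_0_iff field_simps)
  qed
  finally show ?thesis .
qed

text \<open>
  The cap \<open>e k \<le> L R\<^sup>2 / 2\<close> keeps the gap where \<open>t - c t\<^sup>2 / 2LR\<^sup>2\<close> is increasing in \<open>t\<close>; without it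
  an absolute error that is large compared with \<open>R\<close> could carry the gap from below
  \<open>R \<surd>(2 \<epsilon> / c)\<close> to above it.
\<close>

lemma sublinear_recursion:
  fixes e :: "nat \<Rightarrow> real" and L R c \<epsilon> :: real
  assumes pos: "L > 0" "R > 0" "0 < c" "c \<le> 1" "0 \<le> \<epsilon>"
    and nonneg: "\<And>k. 0 \<le> e k"
    and cap: "\<And>k. e k \<le> L / 2 * R\<^sup>2"
    and step: "\<And>k. e (Suc k) \<le> e k - (c * (e k)\<^sup>2 / R\<^sup>2 - \<epsilon>) / (2 * L)"
  shows "e k \<le> max (4 * L * R\<^sup>2 * e 0 / (c * e 0 * real k + 4 * L * R\<^sup>2)) (R * sqrt (2 * \<epsilon> / c))"
proof -
  define E where "E = R * sqrt (2 * \<epsilon> / c)"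
  define q where "q = c / (4 * L * R\<^sup>2)"
  have E: "0 \<le> E" and E2: "E\<^sup>2 = 2 * \<epsilon> * R\<^sup>2 / c"
    using pos by (auto simp: E_def power_mult_distrib)
  have q: "q > 0" and \<epsilon>_eq: "\<epsilon> / (2 * L) = q * E\<^sup>2"
    using pos by (auto simp: q_def E2 field_simps)
  have step': "e (Suc k) \<le> e k - 2 * q * (e k)\<^sup>2 + q * E\<^sup>2" for k
  proof -
    have "(c * (e k)\<^sup>2 / R\<^sup>2 - \<epsilon>) / (2 * L) = 2 * q * (e k)\<^sup>2 - q * E\<^sup>2"
      using pos unfolding diff_divide_distrib \<epsilon>_eq by (simp add: q_def field_simps)
    with step[of k] show ?thesis by linarith
  qed
  have stays: "e (Suc k) \<le> E" if "e k \<le> E" for k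
  proof (cases "L / 2 * R\<^sup>2 \<le> E")
    case True
    then show ?thesis using cap[of "Suc k"] by linarith
  next
    case False
    \<comment> \<open>The map \<open>t - 2qt\<^sup>2\<close> increases on the interval from \<open>e k\<close> to \<open>E\<close>, as \<open>2q(e k + E) \<le> 1\<close>.\<close>
    have "2 * q * (e k + E) \<le> 2 * q * (L * R\<^sup>2)"
      using False cap[of k] q by (intro mult_left_mono) auto
    also have "\<dots> \<le> 1" using pos by (simp add: q_def field_simps)
    finally have "2 * q * (e k + E) * (E - e k) \<le> 1 * (E - e k)"
      using that by (intro mult_right_mono) auto
    then have "e k - 2 * q * (e k)\<^sup>2 \<le> E - 2 * q * E\<^sup>2"
      by (simp add: algebra_simps power2_eq_square)
    moreover have "0 \<le> q * E\<^sup>2" using q by simp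
    ultimately show ?thesis using step'[of k] by linarith
  qed
  have "e k \<le> e 0 / (real k * q * e 0 + 1) \<or> e k \<le> E"
  proof (induction k)
    case (Suc k)
    show ?case
    proof (cases "e k \<le> E")
      case False
      have "q * E\<^sup>2 \<le> q * (e k)\<^sup>2"
        using False E q by (intro mult_left_mono power_mono) auto
      then have "e (Suc k) \<le> e k - q * (e k)\<^sup>2" using step'[of k] by linarith
      with Suc.IH False E q nonneg[of 0]
      have "e (Suc k) \<le> e 0 / ((real k + 1) * q * e 0 + 1)"
        by (intro quadratic_decrease_step[of _ "e k"]) auto
      then show ?thesis by (simp add: add.commute)
    qed (use stays in blast)
  qed simp
  moreover have "e 0 / (real k * q * e 0 + 1)
      = 4 * L * R\<^sup>2 * e 0 / (c * e 0 * real k + 4 * L * R\<^sup>2)"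
  proof -
    have "real k * q * e 0 + 1 = (c * e 0 * real k + 4 * L * R\<^sup>2) / (4 * L * R\<^sup>2)"
      using pos by (simp add: q_def add_divide_distrib)
    then show ?thesis by simp
  qed
  ultimately show ?thesis unfolding E_def by auto
qed

text \<open>
  Measured from its fixed point \<open>D\<close>, an affine recursion is geometric.
\<close>

lemma affine_recursion:
  fixes e :: "nat \<Rightarrow> real"
  assumes "0 \<le> \<rho>" "0 \<le> D" and "\<And>k. e (Suc k) \<le> \<rho> * e k + (1 - \<rho>) * D"
  shows "e k \<le> \<rho> ^ k * e 0 + D"
proof -
  have "e k - D \<le> \<rho> ^ k * (e 0 - D)"
  proof (induction k)
    case (Suc k)
    have "e (Suc k) - D \<le> \<rho> * (e k - D)"
      using assms(3)[of k] by (simp add: algebra_simps)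
    also have "\<dots> \<le> \<rho> * (\<rho> ^ k * (e 0 - D))"
      using Suc assms(1) by (rule mult_left_mono)
    finally show ?case by simp
  qed simp
  moreover have "0 \<le> \<rho> ^ k * D" using assms by simp
  ultimately show ?thesis by (simp add: right_diff_distrib)
qed

section \<open>Convergence rates\<close>

context smooth_convex_minimisation
begin

lemma sublinear_rate:
  assumes eps: "0 \<le> \<epsilon>rel" "\<epsilon>rel < 1" "0 \<le> \<epsilon>abs"
    and run: "inexact_gradient_descent grad L \<epsilon>rel \<epsilon>abs x0 x g"
    and bound: "\<And>k. residual (x k) \<le> R"
  defines "e \<equiv> \<lambda>k. f (x k) - fstar"
  shows "e k \<le> max (4 * L * R\<^sup>2 * e 0 / ((1 - \<epsilon>rel) * e 0 * real k + 4 * L * R\<^sup>2))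
                   (R * sqrt (2 * \<epsilon>abs / (1 - \<epsilon>rel)))"
proof -
  have nonneg: "0 \<le> e k" for k using gap_nonneg by (simp add: e_def)
  have gap: "e k \<le> norm (grad (x k)) * R" for k
    using gap_le_gradient_times_residual[of "x k"] mult_left_mono[OF bound[of k] norm_ge_zero[of "grad (x k)"]]
    by (simp add: e_def)
  have cap: "e k \<le> L / 2 * R\<^sup>2" for k
  proof -
    have "L / 2 * (residual (x k))\<^sup>2 \<le> L / 2 * R\<^sup>2"
      using L_pos bound residual_nonneg by (intro mult_left_mono power_mono) auto
    then show ?thesis using gap_le_residual_squared[of "x k"] by (simp add: e_def)
  qed
  have "0 \<le> R" using residual_nonneg bound by (rule order_trans)
  show ?thesis
  proof (cases "R = 0")
    case True
    with cap[of k] show ?thesis by simp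
  next
    case False
    with \<open>0 \<le> R\<close> have R: "R > 0" by simp
    show ?thesis
    proof (rule sublinear_recursion)
      fix k
      have "(e k)\<^sup>2 \<le> (norm (grad (x k)) * R)\<^sup>2"
        using gap nonneg by (rule power_mono)
      then have "(e k)\<^sup>2 / R\<^sup>2 \<le> (norm (grad (x k)))\<^sup>2"
        using R by (simp add: power_mult_distrib pos_divide_le_eq)
      then have "(1 - \<epsilon>rel) * ((e k)\<^sup>2 / R\<^sup>2) \<le> (1 - \<epsilon>rel) * (norm (grad (x k)))\<^sup>2"
        using eps by (intro mult_left_mono) auto
      then have "((1 - \<epsilon>rel) * (e k)\<^sup>2 / R\<^sup>2 - \<epsilon>abs) / (2 * L)
          \<le> ((1 - \<epsilon>rel) * (norm (grad (x k)))\<^sup>2 - \<epsilon>abs) / (2 * L)"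
        using L_pos by (intro divide_right_mono) auto
      then show "e (Suc k) \<le> e k - ((1 - \<epsilon>rel) * (e k)\<^sup>2 / R\<^sup>2 - \<epsilon>abs) / (2 * L)"
        using inexact_step_decrease[OF run, of k] by (simp add: e_def)
    qed (use L_pos R eps nonneg cap in auto)
  qed
qed

lemma linear_rate:
  assumes eps: "0 \<le> \<epsilon>rel" "\<epsilon>rel < 1" "0 \<le> \<epsilon>abs"
    and rsc: "restricted_strongly_convex \<nu> f fstar" and "\<nu> > 0"
    and run: "inexact_gradient_descent grad L \<epsilon>rel \<epsilon>abs x0 x g"
  defines "e \<equiv> \<lambda>k. f (x k) - fstar"
  shows "e k \<le> (1 - (1 - \<epsilon>rel) * \<nu> / (4 * L)) ^ k * e 0 + 2 * \<epsilon>abs / (\<nu> * (1 - \<epsilon>rel))"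
proof (cases "\<forall>y. f y = fstar")
  case True
  \<comment> \<open>For constant \<open>f\<close> the contraction factor may be negative, but every gap is zero.\<close>
  then show ?thesis using eps \<open>\<nu> > 0\<close> by (simp add: e_def)
next
  case False
  then have "\<nu> \<le> L" using restricted_strong_convexity_constant_le[OF rsc] by blast
  define \<rho> where "\<rho> = 1 - (1 - \<epsilon>rel) * \<nu> / (4 * L)"
  define D where "D = 2 * \<epsilon>abs / (\<nu> * (1 - \<epsilon>rel))"
  have "(1 - \<epsilon>rel) * \<nu> \<le> 1 * L"
    using eps \<open>\<nu> \<le> L\<close> \<open>\<nu> > 0\<close> by (intro mult_mono) auto
  then have "0 \<le> \<rho>" using L_pos by (simp add: \<rho>_def pos_divide_le_eq)
  moreover have "0 \<le> D" using eps \<open>\<nu> > 0\<close> by (simp add: D_def)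
  moreover have "e (Suc k) \<le> \<rho> * e k + (1 - \<rho>) * D" for k
  proof -
    have "(1 - \<epsilon>rel) * (\<nu> / 2 * e k) \<le> (1 - \<epsilon>rel) * (norm (grad (x k)))\<^sup>2"
      using restricted_strong_convexity_gradient_lower_bound[OF rsc \<open>\<nu> > 0\<close>, of "x k"] eps
      by (intro mult_left_mono) (auto simp: e_def)
    then have "((1 - \<epsilon>rel) * (\<nu> / 2 * e k) - \<epsilon>abs) / (2 * L)
        \<le> ((1 - \<epsilon>rel) * (norm (grad (x k)))\<^sup>2 - \<epsilon>abs) / (2 * L)"
      using L_pos by (intro divide_right_mono) auto
    then have "e (Suc k) \<le> e k - ((1 - \<epsilon>rel) * (\<nu> / 2 * e k) - \<epsilon>abs) / (2 * L)"
      using inexact_step_decrease[OF run, of k] by (simp add: e_def)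
    also have "\<dots> = \<rho> * e k + \<epsilon>abs / (2 * L)"
      using L_pos by (simp add: \<rho>_def field_simps)
    also have "\<epsilon>abs / (2 * L) = (1 - \<rho>) * D"
      using L_pos eps \<open>\<nu> > 0\<close> by (simp add: \<rho>_def D_def)
    finally show ?thesis .
  qed
  ultimately show ?thesis
    unfolding \<rho>_def[symmetric] D_def[symmetric] by (rule affine_recursion)
qed

end

theorem lemma3p1:
  fixes f :: "real ^ 'd \<Rightarrow> real"
    and grad :: "real ^ 'd \<Rightarrow> real ^ 'd"
    and L \<epsilon>rel \<epsilon>abs fstar :: real
    and x0 :: "real ^ 'd"
  assumes convex: "convex_on UNIV f"
    and min: "is_minimum_of fstar f"
    and grad: "\<And>x. GDERIV f x :> grad x"
    and L_pos: "L > 0"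
    and lipschitz: "\<And>x y. norm (grad x - grad y) \<le> L * norm (x - y)"
    and eps: "0 \<le> \<epsilon>rel" "\<epsilon>rel < 1" "0 \<le> \<epsilon>abs"
  shows
    "(coercive f (solution_set f fstar) \<and> gradient_coercive grad f \<longrightarrow>
        (\<exists>R. \<forall>x g. inexact_gradient_descent grad L \<epsilon>rel \<epsilon>abs x0 x g \<longrightarrow>
             (\<forall>k. proj_residual (solution_set f fstar) (x k) \<le> R)) \<and>
        (\<forall>R x g. inexact_gradient_descent grad L \<epsilon>rel \<epsilon>abs x0 x g \<longrightarrow>
             (\<forall>k. proj_residual (solution_set f fstar) (x k) \<le> R) \<longrightarrow>
             (let e = (\<lambda>k. f (x k) - fstar) in
              \<forall>k. e k \<le> max (4 * L * R\<^sup>2 * e 0 / ((1 - \<epsilon>rel) * e 0 * real k + 4 * L * R\<^sup>2))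
                            (R * sqrt (2 * \<epsilon>abs / (1 - \<epsilon>rel))))))
     \<and>
     (\<forall>\<nu>>0. restricted_strongly_convex \<nu> f fstar \<longrightarrow>
        (\<forall>x g. inexact_gradient_descent grad L \<epsilon>rel \<epsilon>abs x0 x g \<longrightarrow>
             (let e = (\<lambda>k. f (x k) - fstar) in
              \<forall>k. e k \<le> (1 - (1 - \<epsilon>rel) * \<nu> / (4 * L)) ^ k * e 0
                        + 2 * \<epsilon>abs / (\<nu> * (1 - \<epsilon>rel)))))"
proof -
  interpret smooth_convex_minimisation f grad L fstar
    using convex min grad L_pos lipschitz by unfold_locales
  show ?thesis
    unfolding Let_def
    using iterates_residual_bounded[OF eps(2,3)] sublinear_rate[OF eps] linear_rate[OF eps]
    by (intro conjI allI impI) blast+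
qed

end
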